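(* Let $n$ be an integer with $n \geq 3$, and let $T_n(x, y)$ denote the homogenization $y^n T_n(x/y)$ of the Chebyshev polynomial of the first kind $T_n(x)$. Then $$\frac{8}{3} < A_{T_n} < \frac{8}{3} + \frac{2}{3}\left(\sqrt[n]{4} - 1\right) + B\left(\frac{1}{2} - \frac{1}{n}, \frac{1}{2}\right) - \pi.$$ Furthermore, $\lim_{n \to \infty} A_{T_n} = \frac{8}{3}$.
   Context: $T_n(x)$ is the Chebyshev polynomial of the first kind, $T_n(\cos\theta) = \cos(n\theta)$. For a binary form $F(x,y)$ with real coefficients, $A_F$ denotes the area of the set $\{(x, y) \in \mathbb R^2 : |F(x, y)| \leq 1\}$. $B(x,y) = \int_0^1 t^{x-1}(1-t)^{y-1}\,dt$ is the beta function. *)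

theory Defs
  imports "HOL-Analysis.Analysis" "HOL-Computational_Algebra.Polynomial"
begin

definition chebyshev_T :: "nat \<Rightarrow> real poly" where
  "chebyshev_T n = (THE p. \<forall>\<theta>. poly p (cos \<theta>) = cos (real n * \<theta>))"

(* The form y^n p(x/y), expanded so that it is also correct on the line y = 0;
   meant for degree p \<le> n. *)
definition homogenization :: "nat \<Rightarrow> real poly \<Rightarrow> real \<Rightarrow> real \<Rightarrow> real" where
  "homogenization n p x y = (\<Sum>k\<le>n. coeff p k * x ^ k * y ^ (n - k))"

(* measure is 0 on sets of infinite measure, so a positive lower bound on form_area F
   includes the statement that the area is finite. *)
definition form_area :: "(real \<Rightarrow> real \<Rightarrow> real) \<Rightarrow> real" where
  "form_area F = measure lborel {(x, y). \<bar>F x y\<bar> \<le> 1}"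

lemma chebyshev_T_exists:
  "\<exists>p::real poly. degree p \<le> n \<and> (\<forall>\<theta>. poly p (cos \<theta>) = cos (real n * \<theta>))"
proof (induction n rule: less_induct)
  case (less n)
  consider "n = 0" | "n = 1" | m where "n = Suc (Suc m)"
    by (metis One_nat_def not0_implies_Suc)
  then show ?case
  proof cases
    case 1
    then show ?thesis by (intro exI[of _ 1]) auto
  next
    case 2
    then show ?thesis by (intro exI[of _ "[:0, 1:]"]) auto
  next
    case (3 m)
    obtain p :: "real poly" where p: "degree p \<le> m" "\<And>\<theta>. poly p (cos \<theta>) = cos (real m * \<theta>)"
      using less[of m] 3 by auto
    obtain q :: "real poly" where q: "degree q \<le> Suc m"
      "\<And>\<theta>. poly q (cos \<theta>) = cos (real (Suc m) * \<theta>)"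
      using less[of "Suc m"] 3 by blast
    have "degree ([:0, 2:] * q) \<le> n"
      using degree_mult_le[of "[:0, 2:]" q] q(1) 3 by simp
    then have "degree ([:0, 2:] * q - p) \<le> n"
      using p(1) 3 by (intro degree_diff_le) auto
    moreover have "poly ([:0, 2:] * q - p) (cos \<theta>) = cos (real n * \<theta>)" for \<theta>
    proof -
      have "cos (real n * \<theta>) = cos (real (Suc m) * \<theta> + \<theta>)"
        using 3 by (simp add: algebra_simps)
      moreover have "cos (real m * \<theta>) = cos (real (Suc m) * \<theta> - \<theta>)"
        by (simp add: algebra_simps)
      ultimately show ?thesis
        using p(2)[of \<theta>] q(2)[of \<theta>] by (simp only: cos_add cos_diff) (simp add: algebra_simps)
    qed
    ultimately show ?thesis by blast
  qed
qed

lemma chebyshev_T_unique: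
  fixes p q :: "real poly"
  assumes "\<And>\<theta>. poly p (cos \<theta>) = cos (real n * \<theta>)" "\<And>\<theta>. poly q (cos \<theta>) = cos (real n * \<theta>)"
  shows "p = q"
proof (rule ccontr)
  assume "p \<noteq> q"
  then have "finite {x. poly (p - q) x = 0}"
    by (intro poly_roots_finite) simp
  moreover have "{-1..1} \<subseteq> {x. poly (p - q) x = 0}"
  proof
    fix x :: real assume "x \<in> {-1..1}"
    then have "cos (arccos x) = x" by simp
    then show "x \<in> {x. poly (p - q) x = 0}"
      using assms(1)[of "arccos x"] assms(2)[of "arccos x"] by simp
  qed
  ultimately have "finite {-1..1::real}"
    using finite_subset by blast
  then show False by (simp add: infinite_Icc)
qed

lemma chebyshev_T_eqI:
  assumes "\<And>\<theta>. poly p (cos \<theta>) = cos (real n * \<theta>)"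
  shows "chebyshev_T n = p"
  unfolding chebyshev_T_def
  by (rule the_equality) (use assms chebyshev_T_unique in blast)+

lemma degree_chebyshev_T_le: "degree (chebyshev_T n) \<le> n"
  and poly_chebyshev_T_cos: "poly (chebyshev_T n) (cos \<theta>) = cos (real n * \<theta>)"
  using chebyshev_T_exists[of n] chebyshev_T_eqI by metis+

lemma homogenization_eq:
  assumes "degree p \<le> n" "y \<noteq> 0"
  shows "homogenization n p x y = y ^ n * poly p (x / y)"
proof -
  have "poly p (x / y) = (\<Sum>k\<le>n. coeff p k * (x / y) ^ k)"
    unfolding poly_altdef using assms(1)
    by (intro sum.mono_neutral_left) (auto simp: coeff_eq_0)
  then show ?thesis
    using assms(2)
    by (auto simp: homogenization_def sum_distrib_left power_divide power_diff intro!: sum.cong)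
qed

end

theory Submission
  imports Defs
begin

text \<open>In the coordinates \<open>(t, y) = (x / y, y)\<close> the area becomes the integral of
  \<open>|T\<^sub>n(t)| powr (-2/n)\<close> over the real line. For \<open>t > 1\<close>, put \<open>w = t - sqrt (t\<^sup>2 - 1)\<close>; then
  \<open>T\<^sub>n(t) = (w\<^sup>n + w\<^sup>-\<^sup>n) / 2\<close> lies between \<open>w\<^sup>-\<^sup>n / 2\<close> and \<open>w\<^sup>-\<^sup>n\<close>, so the integrand lies between
  \<open>w\<^sup>2\<close> and \<open>4 powr (1/n) w\<^sup>2\<close>, and \<open>w\<^sup>2\<close> has integral \<open>1/3\<close> over \<open>t > 1\<close>. On \<open>[-1, 1]\<close>, substitute \<open>t = - cos \<theta>\<close>
  and put \<open>h = |cos (n \<theta>)| powr (-2/n) \<ge> 1\<close>: the integral of \<open>h sin \<theta>\<close> over \<open>[0, \<pi>]\<close> is at least \<open>2\<close>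
  and, since \<open>(h - 1) (1 - sin \<theta>) \<ge> 0\<close>, at most \<open>2 - \<pi>\<close> plus the integral of \<open>h\<close>, which by
  periodicity is a beta integral. The limit follows by continuity of the beta function, as
  \<open>Beta (1/2) (1/2) = \<pi>\<close>.\<close>

section \<open>The area as an integral over one real variable\<close>

lemma nn_integral_abs_Icc:
  fixes c :: real
  assumes "c \<ge> 0"
  shows "(\<integral>\<^sup>+y. ennreal \<bar>y\<bar> * indicator {-c..c} y \<partial>lborel) = ennreal (c\<^sup>2)"
proof -
  have "(abs has_integral (c * \<bar>c\<bar> / 2 - (-c) * \<bar>-c\<bar> / 2)) {-c..c}"
  \<comment> \<open>The antiderivative \<open>y * \<bar>y\<bar> / 2\<close> covers both signs at
    once. The point 0 is exempted because the product rule below differentiates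
    \<open>abs\<close>.\<close>
  proof (rule fundamental_theorem_of_calculus_interior_strong[of "{0}"])
    fix x assume x: "x \<in> {-c<..<c} - {0}"
    have "(abs has_real_derivative sgn x) (at x)"
    proof (cases "x > 0")
      case True
      have "(abs has_real_derivative 1) (at x)"
        by (rule has_field_derivative_transform_within_open[OF DERIV_ident, of "{0<..}"])
          (use True in auto)
      then show ?thesis
        using True by simp
    next
      case False
      have "(uminus has_real_derivative - 1) (at x)"
        by (auto intro!: derivative_eq_intros)
      then have "(abs has_real_derivative - 1) (at x)"
        by (rule has_field_derivative_transform_within_open[of _ _ _ "{..<0}"])
          (use False x in auto)
      then show ?thesis
        using False x by simp
    qed
    then have "((\<lambda>y. y * \<bar>y\<bar> / 2) has_real_derivative (1 * \<bar>x\<bar> + sgn x * x) / 2) (at x)"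
      by (intro DERIV_cdivide DERIV_mult DERIV_ident)
    moreover have "(1 * \<bar>x\<bar> + sgn x * x) / 2 = \<bar>x\<bar>"
      by (simp add: sgn_if)
    ultimately have "((\<lambda>y. y * \<bar>y\<bar> / 2) has_real_derivative \<bar>x\<bar>) (at x)"
      by simp
    then show "((\<lambda>y. y * \<bar>y\<bar> / 2) has_vector_derivative \<bar>x\<bar>) (at x)"
      by (simp add: has_real_derivative_iff_has_vector_derivative)
  qed (use assms in \<open>auto intro!: continuous_intros\<close>)
  then have "(abs has_integral c\<^sup>2) {-c..c}"
    using assms by (simp add: power2_eq_square)
  then show ?thesis
    by (intro nn_integral_has_integral_lebesgue') auto
qed

text \<open>For fixed \<open>t\<close> this makes the range of \<open>y\<close> a symmetric
  interval. At \<open>a = 0\<close> it would fail, since \<open>0 powr _ = 0\<close> while every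
  \<open>y\<close> satisfies the left side.\<close>

lemma abs_power_mult_le_1_iff:
  fixes y a :: real
  assumes "n > 0" "a \<noteq> 0"
  shows "\<bar>y ^ n * a\<bar> \<le> 1 \<longleftrightarrow> \<bar>y\<bar> \<le> \<bar>a\<bar> powr (- 1 / real n)"
proof -
  have "(\<bar>a\<bar> powr (- 1 / real n)) ^ n = 1 / \<bar>a\<bar>"
  proof -
    have "(\<bar>a\<bar> powr (- 1 / real n)) ^ n = \<bar>a\<bar> powr (- 1 / real n * real n)"
      using assms by (simp only: powr_powr[symmetric]) (simp add: powr_realpow)
    then show ?thesis
      using assms by (simp add: powr_minus_divide)
  qed
  moreover have "\<bar>y\<bar> \<le> \<bar>a\<bar> powr (- 1 / real n) \<longleftrightarrow> \<bar>y\<bar> ^ n \<le> (\<bar>a\<bar> powr (- 1 / real n)) ^ n"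
    using assms by (intro power_mono_iff[symmetric]) auto
  moreover have "\<bar>y ^ n * a\<bar> \<le> 1 \<longleftrightarrow> \<bar>y\<bar> ^ n \<le> 1 / \<bar>a\<bar>"
    using assms by (simp add: abs_mult power_abs field_simps)
  ultimately show ?thesis
    by simp
qed

text \<open>Slice at fixed \<open>y\<close>, substitute \<open>x = y * t\<close> with Jacobian
  \<open>\<bar>y\<bar>\<close>, and exchange the integrals. For fixed \<open>t\<close> what remains
  is the integral of \<open>\<bar>y\<bar>\<close> over \<open>{-c..c}\<close>, which is
  \<open>c\<^sup>2\<close>.\<close>

lemma emeasure_homogenization_le_1:
  fixes p :: "real poly"
  assumes "n > 0" "degree p \<le> n" "p \<noteq> 0"
  shows "emeasure lborel {(x, y). \<bar>homogenization n p x y\<bar> \<le> 1} =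
    (\<integral>\<^sup>+t. ennreal (\<bar>poly p t\<bar> powr (- 2 / real n)) \<partial>lborel)"
proof -
  let ?S = "{(x, y). \<bar>homogenization n p x y\<bar> \<le> 1}"
  have "continuous_on UNIV (\<lambda>z. homogenization n p (fst z) (snd z))"
    unfolding homogenization_def by (intro continuous_intros)
  then have F: "(\<lambda>z. homogenization n p (fst z) (snd z)) \<in> borel_measurable borel"
    by (rule borel_measurable_continuous_onI)
  have S: "?S \<in> sets (lborel \<Otimes>\<^sub>M lborel)"
  proof -
    have "?S = {z \<in> space borel. \<bar>homogenization n p (fst z) (snd z)\<bar> \<le> 1}"
      by auto
    also have "\<dots> \<in> sets borel"
      using F by measurable
    finally show ?thesis
      by (simp only: lborel_prod sets_lborel)
  qed
  have [measurable]: "poly p \<in> borel_measurable borel"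
    by (intro borel_measurable_continuous_onI continuous_intros)
  have [measurable]: "{(t, y). \<bar>y ^ n * poly p t\<bar> \<le> 1} \<in> sets (borel \<Otimes>\<^sub>M borel)"
  proof -
    have "{z \<in> space (borel \<Otimes>\<^sub>M borel). \<bar>snd z ^ n * poly p (fst z)\<bar> \<le> 1} \<in> sets (borel \<Otimes>\<^sub>M borel)"
      by measurable
    then show ?thesis
      by (simp add: split_def space_pair_measure)
  qed
  have slice: "emeasure lborel {x. \<bar>homogenization n p x y\<bar> \<le> 1} =
      (\<integral>\<^sup>+t. ennreal \<bar>y\<bar> * indicator {(t, y). \<bar>y ^ n * poly p t\<bar> \<le> 1} (t, y) \<partial>lborel)"
    if "y \<noteq> 0" for y
  proof -
    have "{x. \<bar>homogenization n p x y\<bar> \<le> 1} = (\<lambda>x. (x, y)) -` ?S"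
      by auto
    then have [measurable]: "{x. \<bar>homogenization n p x y\<bar> \<le> 1} \<in> sets borel"
      using sets_Pair2[OF S, of y] by simp
    have "emeasure lborel {x. \<bar>homogenization n p x y\<bar> \<le> 1} =
        (\<integral>\<^sup>+x. indicator {x. \<bar>homogenization n p x y\<bar> \<le> 1} x \<partial>lborel)"
      by (rule nn_integral_indicator[symmetric]) simp
    also have "\<dots> = ennreal \<bar>y\<bar> *
        (\<integral>\<^sup>+t. indicator {x. \<bar>homogenization n p x y\<bar> \<le> 1} (0 + y * t) \<partial>lborel)"
      using that by (intro nn_integral_real_affine) auto
    also have "\<dots> = ennreal \<bar>y\<bar> *
        (\<integral>\<^sup>+t. indicator {(t, y). \<bar>y ^ n * poly p t\<bar> \<le> 1} (t, y) \<partial>lborel)"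
      using that by (auto simp: homogenization_eq[OF assms(2)] indicator_def)
    also have "\<dots> = (\<integral>\<^sup>+t. ennreal \<bar>y\<bar> *
        indicator {(t, y). \<bar>y ^ n * poly p t\<bar> \<le> 1} (t, y) \<partial>lborel)"
      by (intro nn_integral_cmult[symmetric]) measurable
    finally show ?thesis .
  qed
  have column: "(\<integral>\<^sup>+y. ennreal \<bar>y\<bar> * indicator {(t, y). \<bar>y ^ n * poly p t\<bar> \<le> 1} (t, y) \<partial>lborel) =
      ennreal (\<bar>poly p t\<bar> powr (- 2 / real n))" if "poly p t \<noteq> 0" for t
  proof -
    define c where "c = \<bar>poly p t\<bar> powr (- 1 / real n)"
    have "(\<integral>\<^sup>+y. ennreal \<bar>y\<bar> * indicator {(t, y). \<bar>y ^ n * poly p t\<bar> \<le> 1} (t, y) \<partial>lborel) =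
        (\<integral>\<^sup>+y. ennreal \<bar>y\<bar> * indicator {-c..c} y \<partial>lborel)"
      using abs_power_mult_le_1_iff[OF assms(1) that]
      by (intro nn_integral_cong) (auto simp: indicator_def c_def abs_le_iff)
    also have "\<dots> = ennreal (c\<^sup>2)"
      by (rule nn_integral_abs_Icc) (simp add: c_def)
    also have "c\<^sup>2 = \<bar>poly p t\<bar> powr (- 2 / real n)"
      by (simp add: c_def power2_eq_square flip: powr_add)
    finally show ?thesis .
  qed
  \<comment> \<open>At a root of \<open>p\<close> the inner integral is infinite but
    \<open>0 powr _\<close> is 0, so the finitely many roots are discarded.\<close>
  have "AE t in lborel. t \<notin> {t. poly p t = 0}"
    using poly_roots_finite[OF assms(3)]
    by (intro AE_not_in finite_imp_null_set_lborel)
  then have AE: "AE t in lborel. poly p t \<noteq> 0"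
    by simp
  have "emeasure lborel ?S = emeasure (lborel \<Otimes>\<^sub>M lborel) ?S"
    by (simp add: lborel_prod)
  also have "\<dots> = (\<integral>\<^sup>+y. emeasure lborel {x. \<bar>homogenization n p x y\<bar> \<le> 1} \<partial>lborel)"
    using S by (subst lborel_pair.emeasure_pair_measure_alt2) auto
  also have "\<dots> = (\<integral>\<^sup>+y. (\<integral>\<^sup>+t. ennreal \<bar>y\<bar> *
      indicator {(t, y). \<bar>y ^ n * poly p t\<bar> \<le> 1} (t, y) \<partial>lborel) \<partial>lborel)"
    \<comment> \<open>The substitution degenerates on the null line \<open>y = 0\<close>.\<close>
    using AE_lborel_singleton[of 0] by (intro nn_integral_cong_AE) (auto simp: slice)
  also have "\<dots> = (\<integral>\<^sup>+t. (\<integral>\<^sup>+y. ennreal \<bar>y\<bar> *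
      indicator {(t, y). \<bar>y ^ n * poly p t\<bar> \<le> 1} (t, y) \<partial>lborel) \<partial>lborel)"
    by (rule lborel_pair.Fubini') measurable
  also have "\<dots> = (\<integral>\<^sup>+t. ennreal (\<bar>poly p t\<bar> powr (- 2 / real n)) \<partial>lborel)"
    using AE by (intro nn_integral_cong_AE) (auto simp: column)
  finally show ?thesis .
qed

section \<open>Chebyshev identities valid on the whole real line\<close>

lemma chebyshev_T_0: "chebyshev_T 0 = 1"
  by (rule chebyshev_T_eqI) simp

lemma chebyshev_T_1: "chebyshev_T (Suc 0) = [:0, 1:]"
  by (rule chebyshev_T_eqI) simp

lemma chebyshev_T_Suc_Suc:
  "chebyshev_T (Suc (Suc n)) = [:0, 2:] * chebyshev_T (Suc n) - chebyshev_T n"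
proof (rule chebyshev_T_eqI)
  fix \<theta> :: real
  have "cos (real (Suc (Suc n)) * \<theta>) = cos (real (Suc n) * \<theta> + \<theta>)"
    "cos (real n * \<theta>) = cos (real (Suc n) * \<theta> - \<theta>)"
    by (simp_all add: algebra_simps)
  then show "poly ([:0, 2:] * chebyshev_T (Suc n) - chebyshev_T n) (cos \<theta>) =
      cos (real (Suc (Suc n)) * \<theta>)"
    by (simp only: poly_diff poly_mult poly_chebyshev_T_cos cos_add cos_diff) simp
qed

lemma chebyshev_T_neq_0: "chebyshev_T n \<noteq> 0"
  using poly_chebyshev_T_cos[of n 0] by auto

lemma poly_chebyshev_T_minus: "poly (chebyshev_T n) (- x) = (- 1) ^ n * poly (chebyshev_T n) x"
  by (induction n rule: induct_nat_012)
    (simp_all add: chebyshev_T_0 chebyshev_T_1 chebyshev_T_Suc_Suc algebra_simps)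

text \<open>Both sides obey the same three-term recurrence. This replaces the cosine formula where
  \<open>\<bar>x\<bar> > 1\<close>.\<close>

lemma poly_chebyshev_T_joukowski:
  assumes "w \<noteq> 0"
  shows "poly (chebyshev_T n) ((w + inverse w) / 2) = (w ^ n + inverse w ^ n) / 2"
proof (induction n rule: induct_nat_012)
  case (ge2 n)
  have "(w + inverse w) * (w ^ Suc n + inverse w ^ Suc n) =
      w ^ Suc (Suc n) + inverse w ^ Suc (Suc n) + (w * inverse w) * (w ^ n + inverse w ^ n)"
    by (simp add: algebra_simps)
  then have prod: "(w + inverse w) * (w ^ Suc n + inverse w ^ Suc n) =
      w ^ Suc (Suc n) + inverse w ^ Suc (Suc n) + (w ^ n + inverse w ^ n)"
    using assms by simp
  have "poly (chebyshev_T (Suc (Suc n))) ((w + inverse w) / 2) =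
      (w + inverse w) * poly (chebyshev_T (Suc n)) ((w + inverse w) / 2) -
      poly (chebyshev_T n) ((w + inverse w) / 2)"
    by (simp add: chebyshev_T_Suc_Suc)
  also have "\<dots> = (w + inverse w) * (w ^ Suc n + inverse w ^ Suc n) / 2 - (w ^ n + inverse w ^ n) / 2"
    unfolding ge2 by simp
  also have "\<dots> = (w ^ Suc (Suc n) + inverse w ^ Suc (Suc n)) / 2"
    unfolding prod by (simp only: add_divide_distrib add_diff_cancel_right')
  finally show ?case .
qed (simp_all add: chebyshev_T_0 chebyshev_T_1)

section \<open>The integral over \<open>t > 1\<close>\<close>

text \<open>The solution \<open>w \<in> (0, 1]\<close> of \<open>(w + 1 / w) / 2 = t\<close>, for \<open>t \<ge> 1\<close>.\<close>

definition joukowski_inv :: "real \<Rightarrow> real" where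
  "joukowski_inv t = t - sqrt (t\<^sup>2 - 1)"

text \<open>Everything follows from the conjugates \<open>t - sqrt (t\<^sup>2 - 1)\<close> and
  \<open>t + sqrt (t\<^sup>2 - 1)\<close> having product 1.\<close>

lemma joukowski_inv:
  assumes "t \<ge> 1"
  shows "0 < joukowski_inv t" "joukowski_inv t \<le> inverse t"
    "inverse (joukowski_inv t) = t + sqrt (t\<^sup>2 - 1)"
proof -
  have t: "t\<^sup>2 \<ge> 1"
    using assms by simp
  have "sqrt (t\<^sup>2 - 1) < sqrt (t\<^sup>2)"
    by (simp only: real_sqrt_less_iff)
  then show pos: "0 < joukowski_inv t"
    using assms by (simp add: joukowski_inv_def)
  have prod: "joukowski_inv t * (t + sqrt (t\<^sup>2 - 1)) = 1"
    using t by (simp add: joukowski_inv_def algebra_simps flip: power2_eq_square)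
  then show inv: "inverse (joukowski_inv t) = t + sqrt (t\<^sup>2 - 1)"
    by (rule inverse_unique)
  have "t \<le> inverse (joukowski_inv t)"
    unfolding inv using t by simp
  then show "joukowski_inv t \<le> inverse t"
    using assms pos by (simp add: field_simps)
qed

lemma joukowski_inv_less_1:
  assumes "t > 1"
  shows "joukowski_inv t < 1"
proof -
  have "joukowski_inv t \<le> inverse t"
    using joukowski_inv assms by simp
  also have "\<dots> < 1"
    using assms by (simp add: inverse_less_1_iff)
  finally show ?thesis .
qed

lemma joukowski_inv_tendsto_0: "(joukowski_inv \<longlongrightarrow> 0) at_top"
proof (rule tendsto_sandwich[OF _ _ tendsto_const tendsto_inverse_0_at_top[OF filterlim_ident]])
  show "\<forall>\<^sub>F t in at_top. 0 \<le> joukowski_inv t"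
    using eventually_ge_at_top[of 1] by eventually_elim (use joukowski_inv in force)
  show "\<forall>\<^sub>F t in at_top. joukowski_inv t \<le> inverse t"
    using eventually_ge_at_top[of 1] by eventually_elim (use joukowski_inv in force)
qed

lemma borel_measurable_joukowski_inv [measurable]: "joukowski_inv \<in> borel_measurable borel"
  unfolding joukowski_inv_def by measurable

lemma nn_integral_joukowski_inv:
  "(\<integral>\<^sup>+t. ennreal ((joukowski_inv t)\<^sup>2) * indicator {1<..} t \<partial>lborel) = ennreal (1 / 3)"
proof -
  \<comment> \<open>With \<open>w = joukowski_inv t\<close> and \<open>t = (w + 1 / w) / 2\<close>,
    the form \<open>w\<^sup>2 dt\<close> equals \<open>(w\<^sup>2 - 1) / 2 dw\<close>, whose
    antiderivative is \<open>w ^ 3 / 6 - w / 2\<close>. As \<open>t\<close> runs from 1 to infinity,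
    \<open>w\<close> falls from 1 to 0.\<close>
  define F where "F = (\<lambda>t. joukowski_inv t ^ 3 / 6 - joukowski_inv t / 2)"
  have F: "(F has_real_derivative (joukowski_inv t)\<^sup>2) (at t)" if "t > 1" for t
  proof -
    define s where "s = sqrt (t\<^sup>2 - 1)"
    have t: "t\<^sup>2 - 1 > 0"
      using that by simp
    then have s: "s > 0" "s\<^sup>2 = t\<^sup>2 - 1"
      by (simp_all add: s_def)
    have w: "(joukowski_inv has_real_derivative 1 - t / s) (at t)"
      unfolding joukowski_inv_def[abs_def]
      using t by (auto intro!: derivative_eq_intros simp: s_def field_simps)
    have "((t - s)\<^sup>2 - 1) / 2 * (1 - t / s) = (t - s)\<^sup>2"
    proof -
      have "(t - s)\<^sup>2 - 1 = 2 * (- s * (t - s))"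
        using s(2) by (simp add: power2_eq_square algebra_simps)
      then have a: "((t - s)\<^sup>2 - 1) / 2 = - s * (t - s)"
        by simp
      have b: "1 - t / s = - (t - s) / s"
        using s(1) by (simp add: field_simps)
      show ?thesis
        unfolding a b using s(1) by (simp add: power2_eq_square) (simp add: algebra_simps)
    qed
    moreover have "(F has_real_derivative ((t - s)\<^sup>2 - 1) / 2 * (1 - t / s)) (at t)"
      unfolding F_def
      by (rule derivative_eq_intros w refl | simp)+
        (simp add: joukowski_inv_def s_def field_simps power2_eq_square)
    ultimately show ?thesis
      by (simp add: joukowski_inv_def s_def)
  qed
  have cont: "continuous_on UNIV joukowski_inv"
    unfolding joukowski_inv_def[abs_def] by (intro continuous_intros)
  then have cont': "isCont joukowski_inv t" for t
    by (simp add: continuous_on_eq_continuous_at)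
  then have "isCont F 1"
    unfolding F_def by (intro continuous_intros) auto
  \<comment> \<open>The square root is not differentiable at \<open>t = 1\<close>, so the endpoint
    enters only as a one-sided limit.\<close>
  then have "(F \<longlongrightarrow> F 1) (at_right 1)"
    by (simp add: isCont_def filterlim_at_split)
  then have A: "((F \<circ> real_of_ereal) \<longlongrightarrow> - 1 / 3) (at_right (ereal 1))"
    by (simp add: ereal_tendsto_simps F_def joukowski_inv_def)
  have "(F \<longlongrightarrow> 0 ^ 3 / 6 - 0 / 2) at_top"
    unfolding F_def by (intro tendsto_intros joukowski_inv_tendsto_0) auto
  then have B: "((F \<circ> real_of_ereal) \<longlongrightarrow> 0) (at_left \<infinity>)"
    by (simp add: ereal_tendsto_simps)
  have "set_integrable lborel (einterval 1 \<infinity>) (\<lambda>t. (joukowski_inv t)\<^sup>2)"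
    "(LBINT t=1..\<infinity>. (joukowski_inv t)\<^sup>2) = 0 - (- 1 / 3)"
    by (rule interval_integral_FTC_nonneg[of 1 \<infinity> F];
      use F A B cont' in \<open>simp add: one_ereal_def\<close>)+
  moreover have "einterval 1 \<infinity> = {1<..}"
    by (auto simp: einterval_def one_ereal_def)
  ultimately have "integrable lborel (\<lambda>t. indicator {1<..} t * (joukowski_inv t)\<^sup>2)"
    "(\<integral>t. indicator {1<..} t * (joukowski_inv t)\<^sup>2 \<partial>lborel) = 1 / 3"
    by (simp_all add: interval_lebesgue_integral_def set_integrable_def set_lebesgue_integral_def)
  then have "(\<integral>\<^sup>+t. ennreal (indicator {1<..} t * (joukowski_inv t)\<^sup>2) \<partial>lborel) = ennreal (1 / 3)"
    by (subst nn_integral_eq_integral) auto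
  then show ?thesis
    by (simp add: ennreal_mult' ennreal_indicator mult.commute)
qed

text \<open>From \<open>0 < w ^ n < inverse w ^ n\<close>, their mean lies strictly between
  \<open>inverse w ^ n / 2\<close> and \<open>inverse w ^ n\<close>; the negative exponent reverses
  the order.\<close>

lemma chebyshev_T_powr_bounds:
  assumes "t > 1" "n > 0"
  shows "(joukowski_inv t)\<^sup>2 < \<bar>poly (chebyshev_T n) t\<bar> powr (- 2 / real n)"
    "\<bar>poly (chebyshev_T n) t\<bar> powr (- 2 / real n) < root n 4 * (joukowski_inv t)\<^sup>2"
proof -
  define w where "w = joukowski_inv t"
  have w: "0 < w" "w < 1"
    using assms joukowski_inv joukowski_inv_less_1 by (simp_all add: w_def)
  have "(w + inverse w) / 2 = t"
    unfolding w_def joukowski_inv(3)[OF less_imp_le[OF assms(1)]] by (simp add: joukowski_inv_def)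
  then have T: "poly (chebyshev_T n) t = (w ^ n + inverse w ^ n) / 2"
    using poly_chebyshev_T_joukowski[of w n] w by simp
  have n: "- 2 / real n < 0"
    using assms by simp
  have "w ^ n < 1"
    using w assms by (simp add: power_less_one_iff)
  moreover have "1 < inverse w ^ n"
    using w assms by (simp add: one_less_inverse)
  ultimately have "w ^ n < inverse w ^ n" "w ^ n > 0"
    using w by simp_all
  then have less: "poly (chebyshev_T n) t < inverse w ^ n" "inverse w ^ n / 2 < poly (chebyshev_T n) t"
    "0 < poly (chebyshev_T n) t"
    unfolding T using w by (simp_all add: add_pos_pos)
  have *: "(inverse w ^ n) powr (- 2 / real n) = w\<^sup>2"
  proof -
    have "(inverse w ^ n) powr (- 2 / real n) = (inverse w powr real n) powr (- 2 / real n)"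
      using w by (simp add: powr_realpow)
    also have "\<dots> = inverse w powr (- 2)"
      using assms by (simp add: powr_powr)
    also have "\<dots> = w\<^sup>2"
      using w by (simp add: powr_minus powr_numeral power_inverse)
    finally show ?thesis .
  qed
  show "(joukowski_inv t)\<^sup>2 < \<bar>poly (chebyshev_T n) t\<bar> powr (- 2 / real n)"
    using powr_less_mono2_neg[OF n less(3) less(1)] less(3) * by (simp add: w_def)
  have **: "(inverse w ^ n / 2) powr (- 2 / real n) = root n 4 * w\<^sup>2"
  proof -
    \<comment> \<open>The factor 1/2 raised to \<open>- 2 / n\<close> is the source of the constant
      \<open>root n 4\<close>.\<close>
    have "2 powr (2 / real n) = (2 powr 2) powr (1 / real n)"
      by (simp only: powr_powr) simp
    then have "root n 4 = 2 powr (2 / real n)"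
      using assms by (simp add: root_powr_inverse powr_numeral)
    moreover have "(inverse w ^ n / 2) powr (- 2 / real n) = w\<^sup>2 / 2 powr (- 2 / real n)"
      using w by (simp only: powr_divide * zero_le_power less_imp_le inverse_nonnegative_iff_nonnegative
          zero_le_numeral)
    ultimately show ?thesis
      by (simp add: powr_minus_divide)
  qed
  show "\<bar>poly (chebyshev_T n) t\<bar> powr (- 2 / real n) < root n 4 * (joukowski_inv t)\<^sup>2"
    using powr_less_mono2_neg[OF n _ less(2)] less w ** by (simp add: w_def)
qed

text \<open>Strictness survives integration because the half-line has positive measure and the
  smaller integral is finite.\<close>

lemma nn_integral_less_on_Ioi:
  fixes f g :: "real \<Rightarrow> real"
  assumes [measurable]: "f \<in> borel_measurable borel" "g \<in> borel_measurable borel"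
  assumes less: "\<And>t. t > a \<Longrightarrow> f t < g t" and nonneg: "\<And>t. t > a \<Longrightarrow> 0 \<le> f t"
    and fin: "(\<integral>\<^sup>+t. ennreal (f t) * indicator {a<..} t \<partial>lborel) < \<infinity>"
  shows "(\<integral>\<^sup>+t. ennreal (f t) * indicator {a<..} t \<partial>lborel) <
    (\<integral>\<^sup>+t. ennreal (g t) * indicator {a<..} t \<partial>lborel)"
proof (rule nn_integral_less)
  show "AE t in lborel. ennreal (f t) * indicator {a<..} t \<le> ennreal (g t) * indicator {a<..} t"
    using less by (auto simp: indicator_def less_imp_le intro!: ennreal_leI)
  show "\<not> (AE t in lborel. ennreal (g t) * indicator {a<..} t \<le> ennreal (f t) * indicator {a<..} t)"
  proof
    assume "AE t in lborel. ennreal (g t) * indicator {a<..} t \<le> ennreal (f t) * indicator {a<..} t"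
    then have "AE t in lborel. t \<notin> {a<..}"
    proof eventually_elim
      case (elim t)
      show ?case
      proof
        assume "t \<in> {a<..}"
        then show False
          using elim less[of t] nonneg[of t] by (simp add: ennreal_le_iff2)
      qed
    qed
    then have "emeasure lborel {a<..} = 0"
      by (subst (asm) AE_iff_measurable[of "{a<..}"]) auto
    moreover have "emeasure lborel {a<..<a + 1} \<le> emeasure lborel {a<..}"
      by (rule emeasure_mono) auto
    ultimately show False
      by simp
  qed
qed (use fin in auto)

lemma nn_integral_chebyshev_T_Ioi:
  assumes "n > 0"
  defines "I \<equiv> \<integral>\<^sup>+t. ennreal (\<bar>poly (chebyshev_T n) t\<bar> powr (- 2 / real n)) * indicator {1<..} t \<partial>lborel"
  shows "ennreal (1 / 3) < I" "I < ennreal (root n 4 / 3)"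
proof -
  have [measurable]: "poly (chebyshev_T n) \<in> borel_measurable borel"
    by (intro borel_measurable_continuous_onI continuous_intros)
  show "ennreal (1 / 3) < I"
    unfolding I_def nn_integral_joukowski_inv[symmetric]
    by (rule nn_integral_less_on_Ioi)
      (use chebyshev_T_powr_bounds[OF _ assms(1)] in \<open>auto simp: nn_integral_joukowski_inv\<close>)
  have "ennreal (root n 4 / 3) = ennreal (root n 4) * ennreal (1 / 3)"
    by (subst ennreal_mult[symmetric]) (auto simp: real_root_ge_zero)
  also have "\<dots> = (\<integral>\<^sup>+t. ennreal (root n 4) * (ennreal ((joukowski_inv t)\<^sup>2) * indicator {1<..} t) \<partial>lborel)"
    unfolding nn_integral_joukowski_inv[symmetric] by (intro nn_integral_cmult[symmetric]) measurable
  also have "\<dots> = (\<integral>\<^sup>+t. ennreal (root n 4 * (joukowski_inv t)\<^sup>2) * indicator {1<..} t \<partial>lborel)"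
    by (intro nn_integral_cong) (simp add: ennreal_mult'' mult.assoc)
  finally have J: "ennreal (root n 4 / 3) = \<dots>" .
  \<comment> \<open>The weak bound comes first, to supply the finiteness of \<open>I\<close> that
    the strict comparison requires.\<close>
  have "I \<le> ennreal (root n 4 / 3)"
    unfolding J I_def using chebyshev_T_powr_bounds(2)[OF _ assms(1)]
    by (intro nn_integral_mono) (auto simp: indicator_def less_imp_le intro!: ennreal_leI)
  then have "I < \<infinity>"
    by (auto simp: top.extremum_strict intro: le_less_trans)
  then show "I < ennreal (root n 4 / 3)"
    unfolding J unfolding I_def
    by (intro nn_integral_less_on_Ioi) (use chebyshev_T_powr_bounds[OF _ assms(1)] in auto)
qed

section \<open>Powers of the cosine and the beta function\<close>

lemma abs_cos_npi_add: "\<bar>cos (real n * pi + x)\<bar> = \<bar>cos x\<bar>"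
  by (simp add: cos_add abs_mult)

text \<open>\<open>\<bar>cos x\<bar>\<close> is even with period \<open>pi\<close>: for
  \<open>k = 2 * j\<close> translate by \<open>j * pi\<close>, and for \<open>k = 2 * j + 1\<close>
  reflect by \<open>x \<mapsto> Suc j * pi - x\<close>.\<close>

lemma nn_integral_abs_cos_powr_quarter_period:
  fixes r :: real
  defines "Q \<equiv> \<integral>\<^sup>+x. ennreal (\<bar>cos x\<bar> powr r) * indicator {0..pi / 2} x \<partial>lborel"
  shows "(\<integral>\<^sup>+x. ennreal (\<bar>cos x\<bar> powr r) * indicator {real k * (pi / 2)..real (Suc k) * (pi / 2)} x \<partial>lborel) = Q"
    (is "(\<integral>\<^sup>+x. ?f x \<partial>lborel) = Q")
proof (cases "even k")
  case True
  then obtain j where k: "k = 2 * j" by blast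
  have "(\<integral>\<^sup>+x. ?f x \<partial>lborel) = ennreal \<bar>1\<bar> * (\<integral>\<^sup>+x. ?f (real j * pi + 1 * x) \<partial>lborel)"
    by (rule nn_integral_real_affine) auto
  moreover have "?f (real j * pi + 1 * x) = ennreal (\<bar>cos x\<bar> powr r) * indicator {0..pi / 2} x" for x
    unfolding abs_cos_npi_add by (simp add: k indicator_def algebra_simps)
  ultimately show ?thesis
    by (simp add: Q_def)
next
  case False
  then obtain j where k: "k = 2 * j + 1" by (rule oddE)
  have "(\<integral>\<^sup>+x. ?f x \<partial>lborel) = ennreal \<bar>- 1\<bar> * (\<integral>\<^sup>+x. ?f (real (Suc j) * pi + (- 1) * x) \<partial>lborel)"
    by (rule nn_integral_real_affine) auto
  moreover have "?f (real (Suc j) * pi + (- 1) * x) = ennreal (\<bar>cos x\<bar> powr r) * indicator {0..pi / 2} x" for x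
  proof -
    have "\<bar>cos (real (Suc j) * pi + (- 1) * x)\<bar> = \<bar>cos x\<bar>"
      unfolding abs_cos_npi_add by simp
    moreover have "real k * (pi / 2) = real (Suc j) * pi - pi / 2" "real (Suc k) * (pi / 2) = real (Suc j) * pi"
      by (simp_all add: k field_simps)
    ultimately show ?thesis
      by (simp only:) (auto simp: indicator_def)
  qed
  ultimately show ?thesis
    by (simp add: Q_def)
qed

lemma nn_integral_abs_cos_powr_quarter_periods:
  fixes r :: real
  shows "(\<integral>\<^sup>+x. ennreal (\<bar>cos x\<bar> powr r) * indicator {0..real k * (pi / 2)} x \<partial>lborel) =
    of_nat k * (\<integral>\<^sup>+x. ennreal (\<bar>cos x\<bar> powr r) * indicator {0..pi / 2} x \<partial>lborel)"
proof (induction k)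
  case 0
  have "AE x in lborel. ennreal (\<bar>cos x\<bar> powr r) * indicator {0..real 0 * (pi / 2)} x = 0"
    using AE_lborel_singleton[of "0 :: real"] by eventually_elim auto
  then show ?case
    by (simp add: nn_integral_0_iff_AE)
next
  case (Suc k)
  let ?f = "\<lambda>x. ennreal (\<bar>cos x\<bar> powr r)"
  have "(\<integral>\<^sup>+x. ?f x * indicator {0..real (Suc k) * (pi / 2)} x \<partial>lborel) =
     (\<integral>\<^sup>+x. ?f x * indicator {0..real k * (pi / 2)} x +
       ?f x * indicator {real k * (pi / 2)..real (Suc k) * (pi / 2)} x \<partial>lborel)"
  \<comment> \<open>The two closed intervals share the point \<open>k * (pi / 2)\<close>, so the
    indicators add up only away from it.\<close>
  proof (intro nn_integral_cong_AE)
    have *: "indicator {0..b} x = (indicator {0..a} x + indicator {a..b} x :: ennreal)"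
      if "0 \<le> a" "a \<le> b" "x \<noteq> a" for a b x :: real
      using that by (auto simp: indicator_def)
    have "0 \<le> real k * (pi / 2)" "real k * (pi / 2) \<le> real (Suc k) * (pi / 2)"
      by (simp_all add: field_simps)
    note * = *[OF this]
    show "AE x in lborel. ?f x * indicator {0..real (Suc k) * (pi / 2)} x =
        ?f x * indicator {0..real k * (pi / 2)} x +
        ?f x * indicator {real k * (pi / 2)..real (Suc k) * (pi / 2)} x"
      using AE_lborel_singleton[of "real k * (pi / 2)"]
      by eventually_elim (simp only: * distrib_left not_False_eq_True)
  qed
  also have "\<dots> = (\<integral>\<^sup>+x. ?f x * indicator {0..real k * (pi / 2)} x \<partial>lborel) +
      (\<integral>\<^sup>+x. ?f x * indicator {real k * (pi / 2)..real (Suc k) * (pi / 2)} x \<partial>lborel)"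
    by (intro nn_integral_add) measurable
  finally show ?case
    by (simp only: Suc nn_integral_abs_cos_powr_quarter_period) (simp add: algebra_simps)
qed

text \<open>Substitute \<open>s = (sin x)\<^sup>2\<close> in the beta integral:
  \<open>s powr (- 1 / 2)\<close> cancels the sine of \<open>ds = 2 * sin x * cos x dx\<close>, and
  the cosine raises the exponent \<open>2 * (a - 1)\<close> by one.\<close>

lemma nn_integral_abs_cos_powr_Beta:
  assumes "a > 0"
  shows "2 * (\<integral>\<^sup>+x. ennreal (\<bar>cos x\<bar> powr (2 * a - 1)) * indicator {0..pi / 2} x \<partial>lborel) =
    ennreal (Beta a (1 / 2))"
proof -
  define f where "f = (\<lambda>s::real. s powr (- 1 / 2) * (1 - s) powr (a - 1))"
  have "(f has_integral Beta (1 / 2) a) {0..1}"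
    using has_integral_Beta_real[of "1 / 2" a] assms by (simp add: f_def)
  then have "ennreal (Beta (1 / 2) a) = (\<integral>\<^sup>+s. ennreal (f s) * indicator {0..1} s \<partial>lborel)"
    by (intro nn_integral_has_integral_lebesgue'[symmetric]) (auto simp: f_def)
  also have "\<dots> = (\<integral>\<^sup>+s. ennreal (f s * indicator {(sin 0)\<^sup>2..(sin (pi / 2))\<^sup>2} s) \<partial>lborel)"
    by (intro nn_integral_cong) (auto simp: indicator_def)
  also have "\<dots> = (\<integral>\<^sup>+x. ennreal (f ((sin x)\<^sup>2) * (2 * sin x * cos x) * indicator {0..pi / 2} x) \<partial>lborel)"
  proof (rule nn_integral_substitution)
    show "set_borel_measurable borel {(sin 0)\<^sup>2..(sin (pi / 2))\<^sup>2} f"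
      unfolding set_borel_measurable_def f_def by measurable
  qed (auto intro!: derivative_eq_intros continuous_intros mult_nonneg_nonneg sin_ge_zero cos_ge_zero)
  also have "\<dots> = (\<integral>\<^sup>+x. 2 * (ennreal (\<bar>cos x\<bar> powr (2 * a - 1)) * indicator {0..pi / 2} x) \<partial>lborel)"
  proof (intro nn_integral_cong_AE)
    show "AE x in lborel. ennreal (f ((sin x)\<^sup>2) * (2 * sin x * cos x) * indicator {0..pi / 2} x) =
        2 * (ennreal (\<bar>cos x\<bar> powr (2 * a - 1)) * indicator {0..pi / 2} x)"
      \<comment> \<open>The power laws below need sine and cosine positive, which fails at the
        endpoints.\<close>
      using AE_lborel_singleton[of "0 :: real"] AE_lborel_singleton[of "pi / 2"]
    proof eventually_elim
      case (elim x)
      show ?case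
      proof (cases "x \<in> {0..pi / 2}")
        case True
        then have pos: "sin x > 0" "cos x > 0"
          using elim by (auto intro!: sin_gt_zero cos_gt_zero)
        have "(sin x)\<^sup>2 powr (- 1 / 2) = (sin x powr 2) powr (- 1 / 2)"
          using pos by (simp add: powr_numeral)
        also have "\<dots> = inverse (sin x)"
          using pos by (simp only: powr_powr) (simp add: powr_minus)
        finally have s: "(sin x)\<^sup>2 powr (- 1 / 2) = inverse (sin x)" .
        have "(1 - (sin x)\<^sup>2) powr (a - 1) * cos x = (cos x powr 2) powr (a - 1) * cos x powr 1"
          using pos by (simp add: powr_numeral flip: cos_squared_eq)
        also have "\<dots> = cos x powr (2 * a - 1)"
          by (simp only: powr_powr powr_add[symmetric]) (simp add: algebra_simps)
        finally have c: "(1 - (sin x)\<^sup>2) powr (a - 1) * cos x = cos x powr (2 * a - 1)" .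
        have "f ((sin x)\<^sup>2) * (2 * sin x * cos x) =
            2 * ((sin x)\<^sup>2 powr (- 1 / 2) * sin x) * ((1 - (sin x)\<^sup>2) powr (a - 1) * cos x)"
          by (simp add: f_def)
        also have "\<dots> = 2 * \<bar>cos x\<bar> powr (2 * a - 1)"
          unfolding s c using pos by simp
        finally have "f ((sin x)\<^sup>2) * (2 * sin x * cos x) = 2 * \<bar>cos x\<bar> powr (2 * a - 1)" .
        then show ?thesis
          using True by (simp only:) (simp add: ennreal_mult')
      qed auto
    qed
  qed
  also have "\<dots> = 2 * (\<integral>\<^sup>+x. ennreal (\<bar>cos x\<bar> powr (2 * a - 1)) * indicator {0..pi / 2} x \<partial>lborel)"
    by (intro nn_integral_cmult) measurable
  finally show ?thesis
    by (simp add: Beta_commute)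
qed

text \<open>Scaling by \<open>n\<close> turns \<open>{0..pi}\<close> into \<open>2 * n\<close>
  quarter periods. Each pair contributes one beta value, and the resulting factor \<open>n\<close>
  cancels the Jacobian.\<close>

lemma nn_integral_abs_cos_mult_powr:
  assumes "a > 0" "n > 0"
  shows "(\<integral>\<^sup>+x. ennreal (\<bar>cos (real n * x)\<bar> powr (2 * a - 1)) * indicator {0..pi} x \<partial>lborel) =
    ennreal (Beta a (1 / 2))" (is "?K = _")
proof -
  let ?f = "\<lambda>x. ennreal (\<bar>cos x\<bar> powr (2 * a - 1)) * indicator {0..real (2 * n) * (pi / 2)} x"
  have "(\<integral>\<^sup>+x. ?f x \<partial>lborel) = ennreal \<bar>real n\<bar> * (\<integral>\<^sup>+x. ?f (0 + real n * x) \<partial>lborel)"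
    using assms by (intro nn_integral_real_affine) auto
  moreover have "?f (0 + real n * x) = ennreal (\<bar>cos (real n * x)\<bar> powr (2 * a - 1)) * indicator {0..pi} x" for x
    using assms by (simp add: indicator_def zero_le_mult_iff)
  ultimately have "of_nat (2 * n) * (\<integral>\<^sup>+x. ennreal (\<bar>cos x\<bar> powr (2 * a - 1)) * indicator {0..pi / 2} x \<partial>lborel) =
      ennreal (real n) * ?K"
    unfolding nn_integral_abs_cos_powr_quarter_periods by simp
  then have "ennreal (real n) * ennreal (Beta a (1 / 2)) = ennreal (real n) * ?K"
    unfolding nn_integral_abs_cos_powr_Beta[OF assms(1), symmetric]
    by (simp add: ennreal_of_nat_eq_real_of_nat[symmetric] algebra_simps)
  then show ?thesis
    using assms by (simp add: ennreal_mult_cancel_left)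
qed

section \<open>The integral over \<open>[-1, 1]\<close>\<close>

text \<open>The upper bound keeps \<open>pi - 2\<close>, the integral of \<open>1 - sin x\<close>
  over \<open>{0..pi}\<close>, on the left, which avoids subtraction in \<open>ennreal\<close>; it
  also shows that \<open>J\<close> is finite.\<close>

lemma nn_integral_chebyshev_T_Icc:
  assumes "n \<ge> 3"
  defines "J \<equiv> \<integral>\<^sup>+t. ennreal (\<bar>poly (chebyshev_T n) t\<bar> powr (- 2 / real n)) * indicator {-1..1} t \<partial>lborel"
  shows "2 \<le> J" "J + ennreal (pi - 2) \<le> ennreal (Beta (1 / 2 - 1 / real n) (1 / 2))"
proof -
  have [measurable]: "poly (chebyshev_T n) \<in> borel_measurable borel"
    by (intro borel_measurable_continuous_onI continuous_intros)
  define h where "h = (\<lambda>x. \<bar>cos (real n * x)\<bar> powr (- 2 / real n))"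
  have [measurable]: "h \<in> borel_measurable borel"
    unfolding h_def by measurable
  have T: "\<bar>poly (chebyshev_T n) (- cos x)\<bar> = \<bar>cos (real n * x)\<bar>" for x
  proof -
    have "poly (chebyshev_T n) (- cos x) = cos (real n * pi + - (real n * x))"
      using poly_chebyshev_T_cos[of n "pi - x"] by (simp add: algebra_simps)
    then show ?thesis
      by (simp only: abs_cos_npi_add) simp
  qed
  \<comment> \<open>Using \<open>- cos\<close> instead of \<open>cos\<close> makes the substitution
    increasing, with derivative \<open>sin x \<ge> 0\<close> on \<open>{0..pi}\<close>.\<close>
  have "J = (\<integral>\<^sup>+t. ennreal (\<bar>poly (chebyshev_T n) t\<bar> powr (- 2 / real n) *
      indicator {- cos 0..- cos pi} t) \<partial>lborel)"
    unfolding J_def by (intro nn_integral_cong) (auto simp: indicator_def)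
  also have "\<dots> = (\<integral>\<^sup>+x. ennreal (\<bar>poly (chebyshev_T n) (- cos x)\<bar> powr (- 2 / real n) * sin x *
      indicator {0..pi} x) \<partial>lborel)"
  proof (rule nn_integral_substitution)
    show "set_borel_measurable borel {- cos 0..- cos pi} (\<lambda>t. \<bar>poly (chebyshev_T n) t\<bar> powr (- 2 / real n))"
      unfolding set_borel_measurable_def by measurable
  qed (auto intro!: derivative_eq_intros continuous_intros sin_ge_zero)
  also have "\<dots> = (\<integral>\<^sup>+x. ennreal (h x * sin x) * indicator {0..pi} x \<partial>lborel)"
    by (intro nn_integral_cong) (auto simp: indicator_def T h_def)
  finally have J: "J = \<dots>" .

  \<comment> \<open>At a zero of \<open>cos (n * x)\<close> the convention
    \<open>0 powr _ = 0\<close> gives \<open>h x = 0\<close>. All zeros lie in this countable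
    set.\<close>
  have "AE x in lborel. x \<notin> (\<Union>i::int. {of_int i * (pi / 2) / real n})"
    by (intro AE_not_in null_sets_UN' finite_imp_null_set_lborel) auto
  then have h: "AE x in lborel. 1 \<le> h x"
  proof eventually_elim
    case (elim x)
    have "cos (real n * x) \<noteq> 0"
    proof
      assume "cos (real n * x) = 0"
      then obtain i :: int where "real n * x = of_int i * (pi / 2)"
        unfolding cos_zero_iff_int by blast
      then have "x = of_int i * (pi / 2) / real n"
        using assms(1) by (simp add: field_simps)
      then show False
        using elim by blast
    qed
    then show ?case
      unfolding h_def using powr_mono2'[of "- 2 / real n" "\<bar>cos (real n * x)\<bar>" 1] assms(1) by simp
  qed

  have "(sin has_integral (- cos pi - - cos 0)) {0..pi}"
    by (rule fundamental_theorem_of_calculus)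
      (auto intro!: derivative_eq_intros simp flip: has_real_derivative_iff_has_vector_derivative)
  then have sin: "(sin has_integral 2) {0..pi}"
    by simp
  then have "2 = (\<integral>\<^sup>+x. ennreal (sin x) * indicator {0..pi} x \<partial>lborel)"
    by (subst nn_integral_has_integral_lebesgue') (auto intro: sin_ge_zero)
  also have "\<dots> \<le> J"
    unfolding J
  proof (intro nn_integral_mono_AE)
    show "AE x in lborel. ennreal (sin x) * indicator {0..pi} x \<le> ennreal (h x * sin x) * indicator {0..pi} x"
      using h
    proof eventually_elim
      case (elim x)
      then show ?case
        using mult_right_mono[of 1 "h x" "sin x"] sin_ge_zero[of x]
        by (auto simp: indicator_def intro!: ennreal_leI)
    qed
  qed
  finally show "2 \<le> J" .

  have "((\<lambda>x. 1 - sin x) has_integral (pi - 2)) {0..pi}"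
    using has_integral_diff[OF has_integral_const_real[of 1 0 pi] sin] by simp
  then have "ennreal (pi - 2) = (\<integral>\<^sup>+x. ennreal (1 - sin x) * indicator {0..pi} x \<partial>lborel)"
    by (subst nn_integral_has_integral_lebesgue') auto
  then have "J + ennreal (pi - 2) =
      (\<integral>\<^sup>+x. ennreal (h x * sin x) * indicator {0..pi} x + ennreal (1 - sin x) * indicator {0..pi} x \<partial>lborel)"
    unfolding J by (subst nn_integral_add) auto
  also have "\<dots> \<le> (\<integral>\<^sup>+x. ennreal (h x) * indicator {0..pi} x \<partial>lborel)"
  proof (intro nn_integral_mono_AE)
    show "AE x in lborel. ennreal (h x * sin x) * indicator {0..pi} x + ennreal (1 - sin x) * indicator {0..pi} x
        \<le> ennreal (h x) * indicator {0..pi} x"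
      using h
    proof eventually_elim
      case (elim x)
      have "0 \<le> (h x - 1) * (1 - sin x)"
        using elim by (intro mult_nonneg_nonneg) auto
      then have "h x * sin x + (1 - sin x) \<le> h x"
        by (simp add: algebra_simps)
      moreover have "0 \<le> h x * sin x" if "x \<in> {0..pi}"
        using that elim sin_ge_zero[of x] by simp
      ultimately show ?case
        by (auto simp: indicator_def simp flip: ennreal_plus intro!: ennreal_leI)
    qed
  qed
  also have "\<dots> = ennreal (Beta (1 / 2 - 1 / real n) (1 / 2))"
  proof -
    \<comment> \<open>The parameter \<open>a = 1 / 2 - 1 / n\<close> is chosen to make
      \<open>2 * a - 1 = - 2 / n\<close>; it is positive because \<open>n \<ge> 3\<close>.\<close>
    have "0 < 1 / 2 - 1 / real n"
      using assms(1) by (simp add: field_simps)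
    moreover have "2 * (1 / 2 - 1 / real n) - 1 = - 2 / real n"
      by simp
    ultimately show ?thesis
      using nn_integral_abs_cos_mult_powr[of "1 / 2 - 1 / real n" n] assms(1) by (simp add: h_def)
  qed
  finally show "J + ennreal (pi - 2) \<le> ennreal (Beta (1 / 2 - 1 / real n) (1 / 2))" .
qed

section \<open>Assembling the bounds and the limit\<close>

text \<open>By parity the two outer half-lines contribute equally.\<close>

lemma nn_integral_chebyshev_T:
  assumes "n > 0"
  defines "f \<equiv> \<lambda>t. ennreal (\<bar>poly (chebyshev_T n) t\<bar> powr (- 2 / real n))"
  shows "(\<integral>\<^sup>+t. f t \<partial>lborel) =
    (\<integral>\<^sup>+t. f t * indicator {-1..1} t \<partial>lborel) + 2 * (\<integral>\<^sup>+t. f t * indicator {1<..} t \<partial>lborel)"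
proof -
  have "poly (chebyshev_T n) \<in> borel_measurable borel"
    by (intro borel_measurable_continuous_onI continuous_intros)
  then have [measurable]: "f \<in> borel_measurable borel"
    unfolding f_def by measurable
  have "f (- t) = f t" for t
    by (simp add: f_def poly_chebyshev_T_minus abs_mult)
  then have "(\<integral>\<^sup>+t. f t * indicator {..<-1} t \<partial>lborel) = (\<integral>\<^sup>+t. f t * indicator {1<..} t \<partial>lborel)"
    by (subst nn_integral_real_affine[where t = 0 and c = "-1"])
      (auto simp: indicator_def intro!: nn_integral_cong)
  moreover have "(\<integral>\<^sup>+t. f t \<partial>lborel) =
      (\<integral>\<^sup>+t. f t * indicator {-1..1} t + (f t * indicator {1<..} t + f t * indicator {..<-1} t) \<partial>lborel)"
    by (intro nn_integral_cong) (auto simp: indicator_def)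
  ultimately show ?thesis
    by (simp add: nn_integral_add mult_2)
qed

text \<open>The area is \<open>J + 2 * I\<close>. The lower bound is \<open>2 + 2 * (1 / 3)\<close>;
  the upper one is \<open>(Beta - (pi - 2)) + 2 * (root n 4 / 3)\<close>, rearranged. Both are
  strict because the bounds on \<open>I\<close> are.\<close>

lemma form_area_chebyshev_T_bounds:
  assumes "n \<ge> 3"
  defines "A \<equiv> form_area (homogenization n (chebyshev_T n))"
  shows "8 / 3 < A"
    "A < 8 / 3 + 2 / 3 * (root n 4 - 1) + Beta (1 / 2 - 1 / real n) (1 / 2) - pi"
proof -
  define I where "I = (\<integral>\<^sup>+t. ennreal (\<bar>poly (chebyshev_T n) t\<bar> powr (- 2 / real n)) * indicator {1<..} t \<partial>lborel)"
  define J where "J = (\<integral>\<^sup>+t. ennreal (\<bar>poly (chebyshev_T n) t\<bar> powr (- 2 / real n)) * indicator {-1..1} t \<partial>lborel)"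
  have n: "n > 0"
    using assms(1) by simp
  have I: "ennreal (1 / 3) < I" "I < ennreal (root n 4 / 3)"
    using nn_integral_chebyshev_T_Ioi[OF n] by (simp_all add: I_def)
  have J: "2 \<le> J" "J + ennreal (pi - 2) \<le> ennreal (Beta (1 / 2 - 1 / real n) (1 / 2))"
    using nn_integral_chebyshev_T_Icc[OF assms(1)] by (simp_all add: J_def)
  obtain i where i: "I = ennreal i" "i \<ge> 0"
    using I(2) by (cases I) auto
  obtain j where j: "J = ennreal j" "j \<ge> 0"
    using J(2) by (cases J) (auto simp: top_unique)
  have "emeasure lborel {(x, y). \<bar>homogenization n (chebyshev_T n) x y\<bar> \<le> 1} = J + 2 * I"
    unfolding I_def J_def nn_integral_chebyshev_T[OF n, symmetric]
    by (intro emeasure_homogenization_le_1 n degree_chebyshev_T_le chebyshev_T_neq_0)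
  also have "\<dots> = ennreal (j + 2 * i)"
    using i j by (simp add: ennreal_plus ennreal_mult')
  finally have A: "A = j + 2 * i"
    using i j by (simp add: A_def form_area_def measure_def del: ennreal_plus)
  have i': "1 / 3 < i" "i < root n 4 / 3"
    using I i by (simp_all add: ennreal_less_iff)
  have j': "2 \<le> j"
    using J(1) j(2) by (simp add: j(1) flip: ennreal_numeral)
  have j'': "j + (pi - 2) \<le> Beta (1 / 2 - 1 / real n) (1 / 2)"
  proof -
    have "ennreal (j + (pi - 2)) \<le> ennreal (Beta (1 / 2 - 1 / real n) (1 / 2))"
      using J(2) j pi_ge_two by (simp add: ennreal_plus)
    \<comment> \<open>\<open>ennreal\<close> sends all nonpositive reals to 0; positivity of the
      left side lets the inequality pass back to the reals.\<close>
    moreover have "0 < j + (pi - 2)"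
      using \<open>2 \<le> j\<close> pi_ge_two by simp
    ultimately show ?thesis
      by (simp add: ennreal_le_iff2)
  qed
  show "8 / 3 < A"
    unfolding A using i' j' by simp
  have "j + 2 * i < 8 / 3 + 2 / 3 * (r - 1) + b - pi" if "i < r / 3" "j + (pi - 2) \<le> b" for r b
    using that by (simp add: field_simps)
  then show "A < 8 / 3 + 2 / 3 * (root n 4 - 1) + Beta (1 / 2 - 1 / real n) (1 / 2) - pi"
    unfolding A using i'(2) j'' by blast
qed

lemma Beta_half_half: "Beta (1 / 2) (1 / 2 :: real) = pi"
  by (simp add: Beta_def Gamma_one_half_real)

theorem theorem2:
  shows "(\<forall>n::nat. n \<ge> 3 \<longrightarrow>
            8 / 3 < form_area (homogenization n (chebyshev_T n)) \<and>
            form_area (homogenization n (chebyshev_T n)) <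
              8 / 3 + 2 / 3 * (root n 4 - 1) + Beta (1 / 2 - 1 / real n) (1 / 2) - pi)
         \<and> (\<lambda>n. form_area (homogenization n (chebyshev_T n))) \<longlonglongrightarrow> 8 / 3"
proof -
  let ?A = "\<lambda>n. form_area (homogenization n (chebyshev_T n))"
  let ?U = "\<lambda>n. 8 / 3 + 2 / 3 * (root n 4 - 1) + Beta (1 / 2 - 1 / real n) (1 / 2) - pi"
  have "(\<lambda>n. 1 / 2 - 1 / real n) \<longlonglongrightarrow> 1 / 2 - 0"
    by (intro tendsto_intros lim_1_over_n)
  then have "(\<lambda>n. 1 / 2 - 1 / real n) \<longlonglongrightarrow> 1 / 2"
    by simp
  \<comment> \<open>Unfolded, \<open>Beta\<close> is a quotient of Gamma values whose arguments tend
    to 1/2, 1/2 and 1; Gamma is continuous there, and nonzero at 1.\<close>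
  then have "?U \<longlonglongrightarrow> 8 / 3 + 2 / 3 * (1 - 1) + Beta (1 / 2) (1 / 2) - pi"
    unfolding Beta_def
    by (intro tendsto_intros LIMSEQ_root_const) (auto simp: Gamma_eq_zero_iff dest: nonpos_Ints_nonpos)
  then have U: "?U \<longlonglongrightarrow> 8 / 3"
    by (simp add: Beta_half_half)
  have "?A \<longlonglongrightarrow> 8 / 3"
  proof (rule tendsto_sandwich[OF _ _ tendsto_const U])
    show "\<forall>\<^sub>F n in sequentially. 8 / 3 \<le> ?A n"
      using eventually_ge_at_top[of 3]
      by eventually_elim (rule less_imp_le, rule form_area_chebyshev_T_bounds)
    show "\<forall>\<^sub>F n in sequentially. ?A n \<le> ?U n"
      using eventually_ge_at_top[of 3]
      by eventually_elim (rule less_imp_le, rule form_area_chebyshev_T_bounds)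
  qed
  then show ?thesis
    using form_area_chebyshev_T_bounds by blast
qed

end
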